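(* Let $p \in \mathcal{M}_{n,d}$ with all coordinates $p_k > 1$. For $m \in \{0,1,\dots,n-2\}$, every $m$-dimensional face of the logarithmic root polytope $\log P_n(p)$ is given by the convex hull of the vertices $v_{ij}$ for $i \in I$, $j \in J$, where $I, J$ are disjoint nonempty subsets of $[n]$ such that $|I| + |J| = m+2$. Thus there is a bijection between the nontrivial faces of $\log P_n(p)$ and the set of ordered partitions of subsets of $[n]$ with two blocks (ordered pairs $(I,J)$ of disjoint nonempty subsets of $[n]$), where the dimension of the face corresponding to $(I,J)$ is $|I|+|J|-2$.
   Context: $[n]=\{1,\dots,n\}$, $n\ge 2$. $\mathcal{M}_{n,d}$ is the set of all vectors $p=(p_1,\dots,p_n)$ of nonnegative integers with $\sum_i p_i = d$. For $p \in \mathcal{M}_{n,d}$ with all $p_k>1$, put $$a_i := \log\left(\frac{p_i+1}{p_i}\right), \qquad b_j := \log\left(\frac{p_j}{p_j-1}\right),$$ and for $i \ne j$ in $[n]$ $$v_{ij} := \frac{1}{b_j p_j - a_i p_i}\left[a_i e_i - b_j e_j - \frac{a_i - b_j}{n}\mathbf{1}\right] \in \mathbb{R}^n,$$ where $e_1,\dots,e_n$ is the standard basis and $\mathbf{1} = \sum_{k\in[n]} e_k$. The logarithmic root polytope $\log P_n(p)$ is the convex hull of the $2\binom{n}{2}$ points $v_{ij}$, $i \neq j \in [n]$. Nontrivial faces are the faces other than the empty face and the whole polytope. The bijection sends $(I,J)$ to the convex hull of $\{v_{ij} : i \in I, j\in J\}$. *)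

theory Defs
  imports "HOL-Analysis.Analysis"
begin

text \<open>The index set \<open>[n]\<close> is a finite type \<open>'n\<close> with \<open>n = CARD('n)\<close>.\<close>

definition lattice_vectors :: "nat \<Rightarrow> (nat ^ 'n) set" where
  "lattice_vectors d = {p. (\<Sum>i\<in>UNIV. p $ i) = d}"

definition log_up :: "nat ^ 'n \<Rightarrow> 'n \<Rightarrow> real" where
  "log_up p i = ln ((real (p $ i) + 1) / real (p $ i))"

definition log_down :: "nat ^ 'n \<Rightarrow> 'n \<Rightarrow> real" where
  "log_down p j = ln (real (p $ j) / (real (p $ j) - 1))"

text \<open>In the following definition, \<open>axis k 1\<close> is the standard basis vector \<open>e\<^sub>k\<close>, so the inner
  sum is the all-ones vector.\<close>

definition log_root :: "nat ^ 'n \<Rightarrow> 'n \<Rightarrow> 'n \<Rightarrow> real ^ 'n" where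
  "log_root p i j =
     (1 / (log_down p j * real (p $ j) - log_up p i * real (p $ i))) *\<^sub>R
       (log_up p i *\<^sub>R axis i 1 - log_down p j *\<^sub>R axis j 1
         - ((log_up p i - log_down p j) / real CARD('n)) *\<^sub>R (\<Sum>k\<in>UNIV. axis k 1))"

definition log_root_polytope :: "nat ^ 'n \<Rightarrow> (real ^ 'n) set" where
  "log_root_polytope p = convex hull {log_root p i j | i j. i \<noteq> j}"

definition nontrivial_faces :: "(real ^ 'n) set \<Rightarrow> (real ^ 'n) set set" where
  "nontrivial_faces S = {F. F face_of S \<and> F \<noteq> {} \<and> F \<noteq> S}"

definition disjoint_pairs :: "('n set \<times> 'n set) set" where
  "disjoint_pairs = {(I, J). I \<noteq> {} \<and> J \<noteq> {} \<and> I \<inter> J = {}}"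

definition pair_hull :: "nat ^ 'n \<Rightarrow> 'n set \<times> 'n set \<Rightarrow> (real ^ 'n) set" where
  "pair_hull p = (\<lambda>(I, J). convex hull {log_root p i j | i j. i \<in> I \<and> j \<in> J})"

end

theory Submission imports Defs
begin

text \<open>
  Write \<open>a\<^sub>i\<close>, \<open>b\<^sub>j\<close> for the two logarithmic weights and \<open>D\<^sub>i\<^sub>j = b\<^sub>j p\<^sub>j - a\<^sub>i p\<^sub>i\<close>. Since
  \<open>a\<^sub>i p\<^sub>i < 1 < b\<^sub>j p\<^sub>j\<close>, all \<open>D\<^sub>i\<^sub>j\<close> are positive. The point \<open>v\<^sub>i\<^sub>j\<close> is the projection, along the
  all-ones vector, of \<open>(a\<^sub>i e\<^sub>i - b\<^sub>j e\<^sub>j) / D\<^sub>i\<^sub>j\<close>, which is the point where the ray of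
  \<open>a\<^sub>i e\<^sub>i - b\<^sub>j e\<^sub>j\<close> meets the hyperplane \<open>p \<bullet> x = -1\<close>. Up to projection, the polytope is thus a section of the cone
  spanned by the vectors \<open>a\<^sub>i e\<^sub>i - b\<^sub>j e\<^sub>j\<close>, and the halfspaces containing it are described by
  vectors \<open>c\<close> with \<open>a\<^sub>i c\<^sub>i \<le> b\<^sub>j c\<^sub>j\<close> for all \<open>i \<noteq> j\<close> (lemma \<open>inner_log_root\<close>); the vertices
  on the boundary of the halfspace are the \<open>v\<^sub>i\<^sub>j\<close> for which equality holds.

  The inequalities force \<open>c \<ge> 0\<close>. If \<open>c \<noteq> 0\<close> and one of them is tight, with common value \<open>t\<close>, then
  \<open>a\<^sub>k c\<^sub>k \<le> t \<le> b\<^sub>k c\<^sub>k\<close> for every \<open>k\<close>, so the tight pairs form a product \<open>I \<times> J\<close>, where \<open>I\<close> collects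
  the indices with \<open>a\<^sub>k c\<^sub>k = t\<close> and \<open>J\<close> those with \<open>b\<^sub>k c\<^sub>k = t\<close>; these are disjoint because
  \<open>0 < a\<^sub>k < b\<^sub>k\<close> and \<open>t > 0\<close> (lemma \<open>tight_pairs_form_product\<close>). Conversely, every pair of disjoint
  nonempty sets arises: take \<open>c\<^sub>k = 1/a\<^sub>k\<close> on \<open>I\<close>, \<open>c\<^sub>k = 1/b\<^sub>k\<close> on \<open>J\<close>, and any value strictly between
  the two elsewhere (lemma \<open>product_is_tight\<close>). As every face of a polytope is exposed, this is the
  bijection.

  The dimensions need no linear algebra. Enlarging \<open>I\<close> or \<open>J\<close> by one index strictly enlarges the
  face, hence raises its dimension by at least one. Any \<open>(I,J)\<close> lies on a chain of such steps from a
  vertex, of dimension \<open>0\<close> and with \<open>card I + card J = 2\<close>, to a face with \<open>card I + card J = n\<close>. The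
  latter is a proper face of a polytope inside a hyperplane, so its dimension is at most \<open>n - 2\<close>,
  and therefore every step raises the dimension by exactly one.
\<close>

section \<open>The logarithmic weights\<close>

lemma log_up_pos:
  assumes "p $ i > 0"
  shows "log_up p i > 0"
  using assms by (simp add: log_up_def field_simps)

lemma log_up_mult_less_one:
  assumes "p $ i > 0"
  shows "log_up p i * real (p $ i) < 1"
proof -
  have "ln (1 + 1 / real (p $ i)) < 1 / real (p $ i)"
    using assms by (intro ln_add_one_self_less_self) auto
  moreover have "(real (p $ i) + 1) / real (p $ i) = 1 + 1 / real (p $ i)"
    using assms by (simp add: field_simps)
  ultimately show ?thesis
    using assms by (simp add: log_up_def field_simps)
qed

text \<open>For \<open>p\<^sub>j = q + 1\<close>, the weight \<open>b\<^sub>j = - log (q/(q+1))\<close> exceeds \<open>1 - q/(q+1) = 1/p\<^sub>j\<close>.\<close>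

lemma log_down_mult_greater_one:
  assumes "p $ j > 1"
  shows "log_down p j * real (p $ j) > 1"
proof -
  let ?x = "real (p $ j)"
  have "ln ((?x - 1) / ?x) < (?x - 1) / ?x - 1"
    using assms ln_le_minus_one[of "(?x - 1) / ?x"] ln_eq_minus_one[of "(?x - 1) / ?x"]
    by (auto simp: less_le field_simps)
  moreover have "log_down p j = - ln ((?x - 1) / ?x)"
    using assms by (simp add: log_down_def ln_div)
  moreover have "(?x - 1) / ?x - 1 = - (1 / ?x)"
    using assms by (simp add: field_simps)
  ultimately have "log_down p j > 1 / ?x" by linarith
  then show ?thesis using assms by (simp add: field_simps)
qed

lemma log_up_less_log_down:
  assumes "p $ k > 1"
  shows "log_up p k < log_down p k"
proof -
  have "log_up p k * real (p $ k) < log_down p k * real (p $ k)"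
    using log_up_mult_less_one[of p k] log_down_mult_greater_one[of p k] assms by linarith
  then show ?thesis
    by (simp add: mult_less_cancel_right)
qed

section \<open>Tight index pairs\<close>

lemma ex_other_element:
  assumes "CARD('n::finite) \<ge> 2"
  shows "\<exists>j. j \<noteq> (i :: 'n)"
  using assms
  by (metis (full_types) card_le_Suc0_iff_eq finite not_less_eq_eq numeral_2_eq_2)

lemma nonneg_if_dominated:
  fixes a b c :: "'n::finite \<Rightarrow> real"
  assumes card: "CARD('n) \<ge> 2"
    and ab: "\<And>k. 0 < a k" "\<And>k. a k < b k"
    and le: "\<And>i j. i \<noteq> j \<Longrightarrow> a i * c i \<le> b j * c j"
  shows "c i \<ge> 0"
proof (rule ccontr)
  assume "\<not> c i \<ge> 0"
  then have ci: "c i < 0" by simp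
  obtain j where "j \<noteq> i"
    using ex_other_element[OF card] by blast
  \<comment> \<open>A negative entry reverses \<open>a < b\<close>, and it makes every other entry negative too, so that
    going from \<open>j\<close> to \<open>i\<close> and back yields a strict cycle.\<close>
  have "a j * c j \<le> b i * c i" using le \<open>j \<noteq> i\<close> by blast
  also have "\<dots> < a i * c i" using ci ab by simp
  also have "\<dots> \<le> b j * c j" using le \<open>j \<noteq> i\<close> by metis
  finally have cyc: "a j * c j < b j * c j" .
  have "a i * c i < 0" using ci ab by (simp add: mult_pos_neg)
  then have "a j * c j < 0"
    using \<open>a j * c j \<le> b i * c i\<close> \<open>b i * c i < a i * c i\<close> by linarith
  then have "c j < 0" using ab(1)[of j] by (simp add: mult_less_0_iff)
  then have "b j * c j < a j * c j" using ab(2)[of j] by simp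
  with cyc show False by simp
qed

text \<open>
  The vectors \<open>c\<close> below form the dual, up to sign, of the cone spanned by the \<open>a\<^sub>i e\<^sub>i - b\<^sub>j e\<^sub>j\<close>;
  the tight pairs name the generators on the face of that cone which \<open>c\<close> exposes.
\<close>

lemma tight_pairs_form_product:
  fixes a b c :: "'n::finite \<Rightarrow> real"
  assumes card: "CARD('n) \<ge> 2"
    and ab: "\<And>k. 0 < a k" "\<And>k. a k < b k"
    and le: "\<And>i j. i \<noteq> j \<Longrightarrow> a i * c i \<le> b j * c j"
    and tight: "i0 \<noteq> j0" "a i0 * c i0 = b j0 * c j0"
    and nonzero: "c k0 \<noteq> 0"
  obtains I J where "(I, J) \<in> disjoint_pairs"
    and "\<And>i j. i \<noteq> j \<Longrightarrow> a i * c i = b j * c j \<longleftrightarrow> i \<in> I \<and> j \<in> J"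
proof -
  define t where "t = a i0 * c i0"
  have t': "t = b j0 * c j0" using tight t_def by simp
  have nonneg: "c k \<ge> 0" for k
    using nonneg_if_dominated[of a b c] card ab le by blast
  have abk: "a k * c k \<le> b k * c k" for k
    using nonneg[of k] ab(2)[of k] by (simp add: mult_right_mono)
  have up: "a k * c k \<le> t" for k
    using le[of k j0] abk[of k] t' by (cases "k = j0") auto
  have down: "t \<le> b k * c k" for k
    using le[of i0 k] abk[of k] t_def by (cases "k = i0") auto
  have "t > 0"
  proof -
    have "0 < a k0 * c k0" using ab nonneg[of k0] nonzero by (simp add: less_le)
    then show ?thesis using up[of k0] by linarith
  qed
  show thesis
  proof
    show "({i. a i * c i = t}, {j. b j * c j = t}) \<in> disjoint_pairs"
    proof -
      have "a k * c k \<noteq> b k * c k" if "a k * c k = t" for k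
        using that \<open>t > 0\<close> ab(2)[of k] by auto
      then show ?thesis
        using t_def t' by (fastforce simp: disjoint_pairs_def)
    qed
    show "a i * c i = b j * c j \<longleftrightarrow> i \<in> {i. a i * c i = t} \<and> j \<in> {j. b j * c j = t}"
      for i j
      using up[of i] down[of j] by auto
  qed
qed

lemma product_is_tight:
  fixes a b :: "'n::finite \<Rightarrow> real"
  assumes ab: "\<And>k. 0 < a k" "\<And>k. a k < b k"
    and disj: "I \<inter> J = {}"
  obtains c where "\<And>i j. a i * c i \<le> b j * c j"
    and "\<And>i j. a i * c i = b j * c j \<longleftrightarrow> i \<in> I \<and> j \<in> J"
proof
  \<comment> \<open>The common value of the tight pairs is normalised to \<open>1\<close>. Off \<open>I \<union> J\<close>, the midpoint of
    \<open>1/b\<close> and \<open>1/a\<close> serves only to give \<open>a c < 1 < b c\<close>.\<close>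
  define c where "c k = (if k \<in> I then 1 / a k else if k \<in> J then 1 / b k
      else (1 / a k + 1 / b k) / 2)" for k
  have b: "0 < b k" for k using ab[of k] by linarith
  have up: "a k * c k \<le> 1 \<and> (a k * c k = 1 \<longleftrightarrow> k \<in> I)" for k
    using ab[of k] b[of k] by (auto simp: c_def field_simps)
  have down: "1 \<le> b k * c k \<and> (b k * c k = 1 \<longleftrightarrow> k \<in> J)" for k
    using ab[of k] b[of k] disj by (auto simp: c_def field_simps)
  show "a i * c i \<le> b j * c j" for i j
    using up[of i] down[of j] by linarith
  show "a i * c i = b j * c j \<longleftrightarrow> i \<in> I \<and> j \<in> J" for i j
    using up[of i] down[of j] by auto
qed

section \<open>Faces of the logarithmic root polytope\<close>

abbreviation log_roots :: "nat ^ 'n \<Rightarrow> (real ^ 'n) set" where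
  "log_roots p \<equiv> {log_root p i j | i j. i \<noteq> j}"

lemma finite_log_roots: "finite (log_roots p)"
proof (rule finite_subset)
  show "log_roots p \<subseteq> (\<lambda>(i, j). log_root p i j) ` UNIV" by auto
qed simp

lemma inner_log_root_expand:
  "y \<bullet> log_root p i j =
     (log_up p i * y $ i - log_down p j * y $ j
       - (log_up p i - log_down p j) * (\<Sum>k\<in>UNIV. y $ k) / real CARD('n))
     / (log_down p j * real (p $ j) - log_up p i * real (p $ i))"
  for y :: "real ^ 'n"
  by (simp add: log_root_def inner_diff_right inner_sum_right inner_axis)

text \<open>
  Affine functionals on the sum-zero hyperplane become linear functionals on the whole space: the
  constant \<open>\<beta>\<close> is absorbed by \<open>\<beta> p\<close>, as \<open>p\<close> takes the value \<open>-1\<close> at all unprojected roots, and the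
  component of \<open>y\<close> along the all-ones vector is invisible to the roots.
\<close>

lemma inner_log_root:
  fixes p :: "nat ^ 'n"
  assumes p: "\<forall>k. p $ k > 1"
    and c: "\<And>k. c k = y $ k - (\<Sum>k\<in>UNIV. y $ k) / real CARD('n) + \<beta> * real (p $ k)"
  shows "y \<bullet> log_root p i j \<le> \<beta> \<longleftrightarrow> log_up p i * c i \<le> log_down p j * c j"
    and "y \<bullet> log_root p i j = \<beta> \<longleftrightarrow> log_up p i * c i = log_down p j * c j"
proof -
  define D where "D = log_down p j * real (p $ j) - log_up p i * real (p $ i)"
  have "p $ i > 0" using p by (meson less_trans zero_less_one)
  then have D: "D > 0"
    using log_up_mult_less_one[of p i] log_down_mult_greater_one[of p j] p
    unfolding D_def by (smt (verit))
  have "y \<bullet> log_root p i j = \<beta> + (log_up p i * c i - log_down p j * c j) / D"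
  proof -
    have "log_up p i * c i - log_down p j * c j = log_up p i * y $ i - log_down p j * y $ j
       - (log_up p i - log_down p j) * (\<Sum>k\<in>UNIV. y $ k) / real CARD('n) - \<beta> * D"
      unfolding c D_def by (simp add: algebra_simps diff_divide_distrib)
    then have "y \<bullet> log_root p i j = (log_up p i * c i - log_down p j * c j + \<beta> * D) / D"
      unfolding inner_log_root_expand D_def[symmetric] by simp
    then show ?thesis using D by (simp add: add_divide_distrib)
  qed
  with D show "y \<bullet> log_root p i j \<le> \<beta> \<longleftrightarrow> log_up p i * c i \<le> log_down p j * c j"
    and "y \<bullet> log_root p i j = \<beta> \<longleftrightarrow> log_up p i * c i = log_down p j * c j"
    by (auto simp: divide_le_0_iff)
qed

lemma face_of_convex_hull_eq:
  fixes S :: "'a::euclidean_space set"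
  assumes "compact S" and "F face_of convex hull S"
  shows "F = convex hull (S \<inter> F)"
proof
  obtain T where T: "T \<subseteq> S" "F = convex hull T"
    using face_of_convex_hull_subset[OF assms] by blast
  then have "T \<subseteq> S \<inter> F" by (simp add: hull_subset)
  then show "F \<subseteq> convex hull (S \<inter> F)" using T by (simp add: hull_mono)
  show "convex hull (S \<inter> F) \<subseteq> F"
    using face_of_imp_convex[OF assms(2)] by (simp add: hull_minimal)
qed

lemma face_eq_pair_hull:
  assumes F: "F face_of log_root_polytope p" and "I \<inter> J = {}"
    and roots: "\<And>i j. i \<noteq> j \<Longrightarrow> log_root p i j \<in> F \<longleftrightarrow> i \<in> I \<and> j \<in> J"
  shows "F = pair_hull p (I, J)"
proof -
  have "F = convex hull (log_roots p \<inter> F)"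
    using face_of_convex_hull_eq finite_imp_compact[OF finite_log_roots] F
    unfolding log_root_polytope_def by blast
  also have "log_roots p \<inter> F = {log_root p i j | i j. i \<in> I \<and> j \<in> J}"
  proof
    show "log_roots p \<inter> F \<subseteq> {log_root p i j | i j. i \<in> I \<and> j \<in> J}"
      using roots by auto
    show "{log_root p i j | i j. i \<in> I \<and> j \<in> J} \<subseteq> log_roots p \<inter> F"
    proof clarify
      fix i j assume "i \<in> I" "j \<in> J"
      moreover from this have "i \<noteq> j" using \<open>I \<inter> J = {}\<close> by auto
      ultimately show "log_root p i j \<in> log_roots p \<inter> F" using roots by auto
    qed
  qed
  finally show ?thesis by (simp add: pair_hull_def)
qed

lemma log_root_in_polytope: "i \<noteq> j \<Longrightarrow> log_root p i j \<in> log_root_polytope p"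
  unfolding log_root_polytope_def by (rule hull_inc) auto

text \<open>
  The second conclusion carries the injectivity of the correspondence: a face determines the
  roots in it, and these determine \<open>I\<close> and \<open>J\<close>.
\<close>

lemma pair_hull_is_face:
  fixes p :: "nat ^ 'n"
  assumes p: "\<forall>k. p $ k > 1" and IJ: "I \<inter> J = {}"
  shows "pair_hull p (I, J) face_of log_root_polytope p"
    and "i \<noteq> j \<Longrightarrow> log_root p i j \<in> pair_hull p (I, J) \<longleftrightarrow> i \<in> I \<and> j \<in> J"
proof -
  have pos: "0 < log_up p k" for k
    using p by (meson less_trans log_up_pos zero_less_one)
  obtain c where
    le: "\<And>i j. log_up p i * c i \<le> log_down p j * c j" and
    eq: "\<And>i j. log_up p i * c i = log_down p j * c j \<longleftrightarrow> i \<in> I \<and> j \<in> J"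
    using product_is_tight[of "log_up p" "log_down p" I J] pos p log_up_less_log_down IJ
    by metis
  \<comment> \<open>Split \<open>c = y + \<beta> p\<close> with \<open>y\<close> of coordinate sum zero.\<close>
  define \<beta> where "\<beta> = (\<Sum>k\<in>UNIV. c k) / (\<Sum>k\<in>UNIV. real (p $ k))"
  define y :: "real ^ 'n" where "y = (\<chi> k. c k - \<beta> * real (p $ k))"
  have "(\<Sum>k\<in>UNIV. real (p $ k)) > 0"
    using p by (intro sum_pos) (auto intro: less_trans[OF zero_less_one])
  then have "(\<Sum>k\<in>UNIV. c k) = \<beta> * (\<Sum>k\<in>UNIV. real (p $ k))"
    by (simp add: \<beta>_def)
  then have "(\<Sum>k\<in>UNIV. y $ k) = 0"
    by (simp add: y_def sum_subtractf flip: sum_distrib_left)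
  then have c: "c k = y $ k - (\<Sum>k\<in>UNIV. y $ k) / real CARD('n) + \<beta> * real (p $ k)" for k
    by (simp add: y_def)
  define F where "F = log_root_polytope p \<inter> {x. y \<bullet> x = \<beta>}"
  have "log_roots p \<subseteq> {x. y \<bullet> x \<le> \<beta>}"
    using inner_log_root(1)[OF p c] le by auto
  then have "log_root_polytope p \<subseteq> {x. y \<bullet> x \<le> \<beta>}"
    unfolding log_root_polytope_def by (simp add: hull_minimal convex_halfspace_le)
  then have F: "F face_of log_root_polytope p"
    unfolding F_def
    by (intro face_of_Int_supporting_hyperplane_le) (auto simp: log_root_polytope_def)
  have roots: "log_root p i j \<in> F \<longleftrightarrow> i \<in> I \<and> j \<in> J" if "i \<noteq> j" for i j
    using inner_log_root(2)[OF p c] eq log_root_in_polytope[OF that] by (auto simp: F_def)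
  have "F = pair_hull p (I, J)"
    using face_eq_pair_hull[OF F IJ] roots by blast
  then show "pair_hull p (I, J) face_of log_root_polytope p"
    and "i \<noteq> j \<Longrightarrow> log_root p i j \<in> pair_hull p (I, J) \<longleftrightarrow> i \<in> I \<and> j \<in> J"
    using F roots by auto
qed

lemma nontrivial_face_is_pair_hull:
  fixes p :: "nat ^ 'n"
  assumes card: "CARD('n) \<ge> 2" and p: "\<forall>k. p $ k > 1"
    and F: "F \<in> nontrivial_faces (log_root_polytope p)"
  obtains I J where "(I, J) \<in> disjoint_pairs" and "F = pair_hull p (I, J)"
proof -
  have face: "F face_of log_root_polytope p" and "F \<noteq> {}" "F \<noteq> log_root_polytope p"
    using F by (auto simp: nontrivial_faces_def)
  have "polyhedron (log_root_polytope p)"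
    unfolding log_root_polytope_def
    by (rule polytope_imp_polyhedron[OF polytope_convex_hull[OF finite_log_roots]])
  then obtain y \<beta> where
    sub: "log_root_polytope p \<subseteq> {x. y \<bullet> x \<le> \<beta>}" and
    F_eq: "F = log_root_polytope p \<inter> {x. y \<bullet> x = \<beta>}"
    using face exposed_face_of_polyhedron exposed_face_of_def by metis
  define c where
    "c k = y $ k - (\<Sum>k\<in>UNIV. y $ k) / real CARD('n) + \<beta> * real (p $ k)" for k
  have pos: "0 < log_up p k" for k
    using p by (meson less_trans log_up_pos zero_less_one)
  have le: "log_up p i * c i \<le> log_down p j * c j" if "i \<noteq> j" for i j
    using inner_log_root(1)[OF p c_def] sub log_root_in_polytope[OF that] by blast
  have in_F: "log_root p i j \<in> F \<longleftrightarrow> log_up p i * c i = log_down p j * c j"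
    if "i \<noteq> j" for i j
    using inner_log_root(2)[OF p c_def] log_root_in_polytope[OF that] F_eq by auto
  have hull: "F = convex hull (log_roots p \<inter> F)"
    using face_of_convex_hull_eq finite_imp_compact[OF finite_log_roots] face
    unfolding log_root_polytope_def by blast
  obtain i0 j0 where tight: "i0 \<noteq> j0" "log_up p i0 * c i0 = log_down p j0 * c j0"
  proof -
    have "log_roots p \<inter> F \<noteq> {}" using hull \<open>F \<noteq> {}\<close> by fastforce
    then show thesis using that in_F by blast
  qed
  obtain k0 where "c k0 \<noteq> 0"
  proof -
    have False if zero: "\<And>k. c k = 0"
    proof -
      have "log_roots p \<subseteq> F" using in_F zero by auto
      then have "log_root_polytope p \<subseteq> F"
        unfolding log_root_polytope_def using face_of_imp_convex[OF face]
        by (simp add: hull_minimal)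
      then show False using F_eq \<open>F \<noteq> log_root_polytope p\<close> by blast
    qed
    then show thesis using that by blast
  qed
  then obtain I J where IJ: "(I, J) \<in> disjoint_pairs"
    and eq: "\<And>i j. i \<noteq> j \<Longrightarrow> log_up p i * c i = log_down p j * c j \<longleftrightarrow> i \<in> I \<and> j \<in> J"
    using tight_pairs_form_product[of "log_up p" "log_down p" c i0 j0 k0]
      card pos log_up_less_log_down p le tight by metis
  have "F = pair_hull p (I, J)"
    using face_eq_pair_hull[OF face] IJ in_F eq by (auto simp: disjoint_pairs_def)
  with IJ show thesis using that by blast
qed

lemma pair_hull_inj:
  fixes p :: "nat ^ 'n"
  assumes p: "\<forall>k. p $ k > 1"
    and "(I, J) \<in> disjoint_pairs" "(I', J') \<in> disjoint_pairs"
    and eq: "pair_hull p (I, J) = pair_hull p (I', J')"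
  shows "I = I' \<and> J = J'"
proof -
  have d: "I \<noteq> {}" "J \<noteq> {}" "I \<inter> J = {}" "I' \<noteq> {}" "J' \<noteq> {}" "I' \<inter> J' = {}"
    using assms(2,3) by (auto simp: disjoint_pairs_def)
  have "i \<in> I \<and> j \<in> J \<longleftrightarrow> i \<in> I' \<and> j \<in> J'" for i j
  proof (cases "i = j")
    case True
    then show ?thesis using d(3,6) by auto
  next
    case False
    then show ?thesis
      using pair_hull_is_face(2)[OF p d(3) False] pair_hull_is_face(2)[OF p d(6) False] eq
      by simp
  qed
  then have "I \<times> J = I' \<times> J'" by auto
  then show ?thesis using d by (simp add: times_eq_iff)
qed

text \<open>For \<open>i \<in> I\<close> and \<open>j \<in> J\<close>, the opposite root \<open>v\<^sub>j\<^sub>i\<close> is missed by the face.\<close>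

lemma pair_hull_nontrivial:
  fixes p :: "nat ^ 'n"
  assumes p: "\<forall>k. p $ k > 1" and IJ: "(I, J) \<in> disjoint_pairs"
  shows "pair_hull p (I, J) \<in> nontrivial_faces (log_root_polytope p)"
proof -
  obtain i j where ij: "i \<in> I" "j \<in> J" and disj: "I \<inter> J = {}"
    using IJ by (auto simp: disjoint_pairs_def)
  then have "i \<noteq> j" by auto
  have "log_root p i j \<in> pair_hull p (I, J)"
    using pair_hull_is_face(2)[OF p disj \<open>i \<noteq> j\<close>] ij by simp
  moreover have "log_root p j i \<notin> pair_hull p (I, J)"
    using pair_hull_is_face(2)[OF p disj, of j i] \<open>i \<noteq> j\<close> ij disj by auto
  moreover have "log_root p j i \<in> log_root_polytope p"
    using log_root_in_polytope \<open>i \<noteq> j\<close> by metis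
  ultimately show ?thesis
    using pair_hull_is_face(1)[OF p disj] by (auto simp: nontrivial_faces_def)
qed

section \<open>Dimensions\<close>

lemma aff_dim_log_root_polytope_le:
  fixes p :: "nat ^ 'n"
  shows "aff_dim (log_root_polytope p) \<le> int CARD('n) - 1"
proof -
  let ?one = "(\<chi> k. 1) :: real ^ 'n"
  have "?one \<bullet> log_root p i j = 0" for i j
    by (simp add: inner_log_root_expand)
  then have "log_root_polytope p \<subseteq> {x. ?one \<bullet> x = 0}"
    unfolding log_root_polytope_def
    by (intro hull_minimal) (auto simp: convex_hyperplane)
  then have "aff_dim (log_root_polytope p) \<le> aff_dim {x. ?one \<bullet> x = 0}"
    by (rule aff_dim_subset)
  also have "\<dots> = int DIM(real ^ 'n) - 1"
    by (subst aff_dim_hyperplane) (auto simp: vec_eq_iff)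
  finally show ?thesis by simp
qed

lemma pair_hull_strict_mono_aff_dim:
  fixes p :: "nat ^ 'n"
  assumes p: "\<forall>k. p $ k > 1"
    and IJ: "(I, J) \<in> disjoint_pairs" and IJ': "(I', J') \<in> disjoint_pairs"
    and sub: "I \<subseteq> I'" "J \<subseteq> J'" and neq: "(I, J) \<noteq> (I', J')"
  shows "aff_dim (pair_hull p (I, J)) < aff_dim (pair_hull p (I', J'))"
proof (rule face_of_aff_dim_lt)
  show "convex (pair_hull p (I', J'))" by (simp add: pair_hull_def)
  have le: "pair_hull p (I, J) \<subseteq> pair_hull p (I', J')"
    unfolding pair_hull_def using sub by (auto intro!: hull_mono)
  have "pair_hull p (I', J') \<subseteq> log_root_polytope p"
    using pair_hull_nontrivial[OF p IJ'] face_of_imp_subset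
    by (auto simp: nontrivial_faces_def)
  then show "pair_hull p (I, J) face_of pair_hull p (I', J')"
    using face_of_subset le pair_hull_nontrivial[OF p IJ]
    by (auto simp: nontrivial_faces_def)
  show "pair_hull p (I, J) \<noteq> pair_hull p (I', J')"
    using pair_hull_inj[OF p IJ IJ'] neq by blast
qed

text \<open>The chain argument: indices are added to the two blocks one at a time.\<close>

lemma aff_dim_pair_hull_gap:
  fixes p :: "nat ^ 'n"
  assumes p: "\<forall>k. p $ k > 1"
    and IJ: "(I, J) \<in> disjoint_pairs" and IJ': "(I', J') \<in> disjoint_pairs"
    and sub: "I \<subseteq> I'" "J \<subseteq> J'"
  shows "aff_dim (pair_hull p (I, J)) + (int (card I' + card J') - int (card I + card J))
    \<le> aff_dim (pair_hull p (I', J'))"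
  using IJ sub
proof (induction "card (I' \<union> J') - card (I \<union> J)" arbitrary: I J rule: less_induct)
  case less
  show ?case
  proof (cases "(I, J) = (I', J')")
    case True
    then show ?thesis by simp
  next
    case False
    have disj': "I' \<inter> J' = {}" using IJ' by (auto simp: disjoint_pairs_def)
    obtain I1 J1 where
      step: "I \<subseteq> I1" "I1 \<subseteq> I'" "J \<subseteq> J1" "J1 \<subseteq> J'" "card I1 + card J1 = Suc (card I + card J)"
    proof (cases "I = I'")
      case True
      then obtain k where "k \<in> J' - J" using False less.prems by blast
      then show thesis using that[of I "insert k J"] less.prems by auto
    next
      case neq: False
      then obtain k where "k \<in> I' - I" using less.prems by blast
      then show thesis using that[of "insert k I" J] less.prems by auto
    qed
    then have pair1: "(I1, J1) \<in> disjoint_pairs"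
      using less.prems disj' by (auto simp: disjoint_pairs_def)
    have cards: "card (I \<union> J) = card I + card J" "card (I1 \<union> J1) = card I1 + card J1"
      using less.prems pair1 by (auto simp: card_Un_disjoint disjoint_pairs_def)
    have "card (I1 \<union> J1) \<le> card (I' \<union> J')"
      using step by (intro card_mono) auto
    have "aff_dim (pair_hull p (I1, J1))
          + (int (card I' + card J') - int (card I1 + card J1))
        \<le> aff_dim (pair_hull p (I', J'))"
      using less.hyps[of I1 J1] pair1 step cards
        \<open>card (I1 \<union> J1) \<le> card (I' \<union> J')\<close> by simp
    moreover have "(I, J) \<noteq> (I1, J1)" using step(5) by auto
    then have "aff_dim (pair_hull p (I, J)) < aff_dim (pair_hull p (I1, J1))"
      using pair_hull_strict_mono_aff_dim[OF p less.prems(1) pair1] step by blast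
    ultimately show ?thesis using step(5) by linarith
  qed
qed

lemma aff_dim_pair_hull:
  fixes p :: "nat ^ 'n"
  assumes p: "\<forall>k. p $ k > 1" and IJ: "(I, J) \<in> disjoint_pairs"
  shows "aff_dim (pair_hull p (I, J)) = int (card I) + int (card J) - 2"
    and "aff_dim (log_root_polytope p) = int CARD('n) - 1"
proof -
  obtain i j where ij: "i \<in> I" "j \<in> J" and disj: "I \<inter> J = {}"
    using IJ by (auto simp: disjoint_pairs_def)
  have vertex: "({i}, {j}) \<in> disjoint_pairs"
    using ij disj by (auto simp: disjoint_pairs_def)
  have vertex_dim: "aff_dim (pair_hull p ({i}, {j})) = 0"
    by (simp add: pair_hull_def)
  have lower: "int (card I) + int (card J) - 2 \<le> aff_dim (pair_hull p (I, J))"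
    using aff_dim_pair_hull_gap[OF p vertex IJ] ij vertex_dim by simp
  \<comment> \<open>Enlarging \<open>J\<close> to the complement of \<open>I\<close> ends the chain at a partition of all indices.\<close>
  have facet: "(I, - I) \<in> disjoint_pairs"
    using IJ by (auto simp: disjoint_pairs_def)
  have card_facet: "card I + card (- I) = CARD('n)"
    by (metis Compl_disjoint Compl_partition card_Un_disjoint finite)
  have facet_dim: "aff_dim (pair_hull p (I, - I)) < aff_dim (log_root_polytope p)"
    using pair_hull_nontrivial[OF p facet]
    by (intro face_of_aff_dim_lt) (auto simp: nontrivial_faces_def log_root_polytope_def)
  have upper: "aff_dim (pair_hull p (I, J)) + (int CARD('n) - int (card I + card J))
      \<le> aff_dim (pair_hull p (I, - I))"
    using aff_dim_pair_hull_gap[OF p IJ facet] disj card_facet by auto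
  show "aff_dim (pair_hull p (I, J)) = int (card I) + int (card J) - 2"
    and "aff_dim (log_root_polytope p) = int CARD('n) - 1"
    using lower upper facet_dim aff_dim_log_root_polytope_le[of p] by linarith+
qed

section \<open>The face lattice\<close>

theorem theorem18:
  fixes p :: "nat ^ 'n" and d :: nat
  assumes "CARD('n) \<ge> 2"
    and "p \<in> lattice_vectors d"
    and "\<forall>k. p $ k > 1"
  shows "(\<forall>m \<le> CARD('n) - 2. \<forall>F. F face_of log_root_polytope p \<and> aff_dim F = int m \<longrightarrow>
            (\<exists>I J. (I, J) \<in> disjoint_pairs \<and> card I + card J = m + 2 \<and> F = pair_hull p (I, J)))
       \<and> bij_betw (pair_hull p) disjoint_pairs (nontrivial_faces (log_root_polytope p))
       \<and> (\<forall>(I, J) \<in> disjoint_pairs.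
            aff_dim (pair_hull p (I, J)) = int (card I) + int (card J) - 2)"
proof (intro conjI allI impI)
  note p = assms(3)
  show "\<forall>(I, J) \<in> disjoint_pairs.
      aff_dim (pair_hull p (I, J)) = int (card I) + int (card J) - 2"
    using aff_dim_pair_hull(1)[OF p] by blast
  show "bij_betw (pair_hull p) disjoint_pairs (nontrivial_faces (log_root_polytope p))"
    unfolding bij_betw_def
  proof
    show "inj_on (pair_hull p) disjoint_pairs"
      using pair_hull_inj[OF p] by (auto intro!: inj_onI)
    show "pair_hull p ` disjoint_pairs = nontrivial_faces (log_root_polytope p)"
    proof
      show "pair_hull p ` disjoint_pairs \<subseteq> nontrivial_faces (log_root_polytope p)"
        using pair_hull_nontrivial[OF p] by auto
      show "nontrivial_faces (log_root_polytope p) \<subseteq> pair_hull p ` disjoint_pairs"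
        using nontrivial_face_is_pair_hull[OF assms(1) p] by (metis image_eqI subsetI)
    qed
  qed
  fix m F
  assume m: "m \<le> CARD('n) - 2" and F: "F face_of log_root_polytope p \<and> aff_dim F = int m"
  \<comment> \<open>Some pair exists, so the polytope has dimension \<open>n - 1 > m\<close> and is not \<open>F\<close> itself.\<close>
  obtain i j :: 'n where "i \<noteq> j"
    using ex_other_element[OF assms(1)] by blast
  then have "({i}, {j}) \<in> disjoint_pairs" by (auto simp: disjoint_pairs_def)
  then have "aff_dim (log_root_polytope p) = int CARD('n) - 1"
    using aff_dim_pair_hull(2)[OF p] by blast
  then have "F \<noteq> log_root_polytope p" "F \<noteq> {}"
    using F m assms(1) by auto
  then have "F \<in> nontrivial_faces (log_root_polytope p)"
    using F by (simp add: nontrivial_faces_def)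
  then obtain I J where IJ: "(I, J) \<in> disjoint_pairs" "F = pair_hull p (I, J)"
    using nontrivial_face_is_pair_hull[OF assms(1) p] by blast
  then have "card I + card J = m + 2"
    using aff_dim_pair_hull(1)[OF p IJ(1)] F by simp
  with IJ show "\<exists>I J. (I, J) \<in> disjoint_pairs \<and> card I + card J = m + 2
      \<and> F = pair_hull p (I, J)"
    by blast
qed

end
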